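(* Let $n_1,n_2$ be distinct odd primes with $\gcd(n_1-1,n_2-1)=6$, $n=n_1n_2$, $e=(n_1-1)(n_2-1)/6$, and let $D_0,\dots,D_5$ be the Whiteman generalized cyclotomic classes of order 6 modulo $n$ (see context). Let $q$ be a prime power with $\gcd(q,n)=1$ and $q\bmod n\in D_0$. For $i\in\{1,2\}$ and $0\le j\le 5$, let $\boldsymbol{C_{i,j}}$ be the cyclic code of length $n$ over $\mathrm{GF}(q)$ generated by $g_{i,j}(x)=\frac{x^n-1}{(x^{n_i}-1)d_j(x)}$. Then $\boldsymbol{C_{i,j}}$ has dimension $n_i+\frac{(n_1-1)(n_2-1)}{6}$ and minimum distance $d_{i,j}\ge \lceil\sqrt{n_{3-i}}\,\rceil$ (i.e. $\ge\lceil\sqrt{n_2}\rceil$ for $i=1$ and $\ge\lceil\sqrt{n_1}\rceil$ for $i=2$).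
   Context: Let $g$ be a common primitive root of $n_1$ and $n_2$, $u$ an integer with $u\equiv g\pmod{n_1}$, $u\equiv 1\pmod{n_2}$, and $D_i=\{g^su^i\bmod n: s=0,\dots,e-1\}$ for $i=0,\dots,5$; these partition $\mathbb{Z}_n^*$. Let $m$ be the order of $q$ modulo $n$, $\alpha$ a primitive element of $\mathrm{GF}(q^m)$, $\beta=\alpha^{(q^m-1)/n}$, and $d_j(x)=\prod_{k\in D_j}(x-\beta^k)$. When $q\bmod n\in D_0$, each $d_j(x)$ has coefficients in $\mathrm{GF}(q)$. *)

theory Defs
  imports "HOL-Number_Theory.Number_Theory" "HOL-Computational_Algebra.Polynomial" "HOL-Library.Cardinality"
begin

text \<open>Whiteman generalized cyclotomic class D_i of order 6 modulo n = n1*n2,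
  with respect to a common primitive root g and the CRT element u.\<close>
definition whiteman_class :: "nat \<Rightarrow> nat \<Rightarrow> nat \<Rightarrow> nat \<Rightarrow> nat \<Rightarrow> nat set" where
  "whiteman_class n1 n2 g u i =
     {(g ^ s * u ^ i) mod (n1 * n2) | s. s < (n1 - 1) * (n2 - 1) div 6}"

definition d_poly :: "'b::field \<Rightarrow> nat set \<Rightarrow> 'b poly" where
  "d_poly \<beta> D = (\<Prod>k\<in>D. [:- (\<beta> ^ k), 1:])"

definition field_embedding :: "('a::field \<Rightarrow> 'b::field) \<Rightarrow> bool" where
  "field_embedding f \<longleftrightarrow> inj f \<and> f 1 = 1 \<and>
     (\<forall>x y. f (x + y) = f x + f y) \<and> (\<forall>x y. f (x * y) = f x * f y)"

definition primitive_element :: "'b::field \<Rightarrow> bool" where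
  "primitive_element \<alpha> \<longleftrightarrow> (\<forall>x. x \<noteq> 0 \<longrightarrow> (\<exists>k::nat. x = \<alpha> ^ k))"

text \<open>Cyclic code of length n generated by gp: the ideal generated by gp in
  F[x]/(x^n - 1), codewords represented by polynomials of degree < n.\<close>
definition cyclic_code :: "nat \<Rightarrow> 'a::field poly \<Rightarrow> 'a poly set" where
  "cyclic_code n gp = {(a * gp) mod (monom 1 n - 1) | a. True}"

definition hamming_weight :: "'a::zero poly \<Rightarrow> nat" where
  "hamming_weight c = card {i. coeff c i \<noteq> 0}"

definition min_distance :: "'a::zero poly set \<Rightarrow> nat" where
  "min_distance C = Min (hamming_weight ` (C - {0}))"

definition code_dim :: "'a::field poly set \<Rightarrow> nat" where
  "code_dim C = vector_space.dim (smult :: 'a \<Rightarrow> 'a poly \<Rightarrow> 'a poly) C"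

end

theory Submission
  imports Defs
begin

text \<open>
  Only the distance bound needs an idea. Let \<open>P\<close> be the prime whose square root is the bound and \<open>R\<close>
  the other one. Restricting the spectrum of a codeword to a fixed residue class modulo \<open>R\<close> folds it,
  without increasing the weight, to a function on the integers modulo \<open>P\<close> whose Fourier transform
  is supported on 0 and a single class of quadratic residues or nonresidues: on a Whiteman class
  the product of the Legendre symbols modulo \<open>n1\<close> and \<open>n2\<close> is constant. So the square root bound for
  quadratic residue codes applies over the splitting field.
  If the transform \<open>V\<close> does not vanish at 0, convolving \<open>v(t)\<close> with \<open>v(rt)\<close>
  for a nonresidue \<open>r\<close> gives a nonzero constant function. If \<open>V(0) = 0\<close>, that product argument
  gives nothing; then one translates \<open>v\<close> to have \<open>v(0) \<noteq> 0\<close> and passes to \<open>\<chi>(t) v(1/t)\<close> (the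
  Gleason-Prange transformation), whose transform is again supported on 0 and one class,
  by the vanishing of Salie sums, and is nonzero at 0, by the nonvanishing of the Gauss sum.
\<close>

subsection \<open>Legendre symbols\<close>

lemma Legendre_values: "Legendre a p \<in> {-1, 0, 1}"
  by (simp add: Legendre_def)

lemma Legendre_eq_0_iff: "Legendre a p = 0 \<longleftrightarrow> p dvd a"
  by (simp add: Legendre_def cong_0_iff)

lemma Legendre_cong: "[a = b] (mod p) \<Longrightarrow> Legendre a p = Legendre b p"
  by (auto simp: Legendre_def QuadRes_def cong_def)

lemma Legendre_mod [simp]: "Legendre (a mod p) p = Legendre a p"
  by (rule Legendre_cong) simp

text \<open>By Euler's criterion both sides are congruent modulo \<open>p\<close>. They lie in {-1,
  0, 1}, so they differ by at most 2, which is less than \<open>p\<close>.\<close>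

lemma Legendre_mult:
  fixes p :: nat
  assumes "prime p" "odd p"
  shows "Legendre (a * b) p = Legendre a p * Legendre b p"
proof -
  have p2: "2 < p"
    using assms prime_ge_2_nat[of p] by (cases "p = 2") auto
  have "[Legendre (a * b) p = (a * b) ^ ((p - 1) div 2)] (mod p)"
    by (rule euler_criterion[OF assms(1) p2])
  moreover have "[Legendre a p * Legendre b p = a ^ ((p - 1) div 2) * b ^ ((p - 1) div 2)] (mod p)"
    by (intro cong_mult euler_criterion assms p2)
  ultimately have "[Legendre (a * b) p = Legendre a p * Legendre b p] (mod p)"
    by (metis cong_sym cong_trans power_mult_distrib)
  then have "int p dvd Legendre (a * b) p - Legendre a p * Legendre b p"
    by (simp add: cong_iff_dvd_diff)
  moreover have "\<bar>Legendre (a * b) p - Legendre a p * Legendre b p\<bar> < int p"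
    using Legendre_values[of "a * b" p] Legendre_values[of a p] Legendre_values[of b p] p2
    by auto
  ultimately show ?thesis
    using zdvd_not_zless[of "\<bar>Legendre (a * b) p - Legendre a p * Legendre b p\<bar>" "int p"] by auto
qed

lemma Legendre_power:
  fixes p :: nat
  assumes "prime p" "odd p"
  shows "Legendre (a ^ k) p = Legendre a p ^ k"
proof (induction k)
  case 0
  have "\<not> int p dvd 1" "QuadRes p 1"
    using assms by (auto simp: QuadRes_def intro: exI[of _ 1])
  then show ?case
    by (simp add: Legendre_def cong_0_iff)
qed (simp add: Legendre_mult assms)

text \<open>If the symbol were 1, Euler's criterion would make the order of \<open>g\<close> divide
  \<open>(p - 1) div 2\<close>, but that order is \<open>p - 1\<close>.\<close>

lemma Legendre_primroot:
  fixes p g :: nat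
  assumes "prime p" "odd p" "residue_primroot p g"
  shows "Legendre g p = -1"
proof -
  have p2: "2 < p"
    using assms prime_ge_2_nat[of p] by (cases "p = 2") auto
  have cop: "coprime p g" and ord: "ord p g = p - 1"
    using assms by (auto simp: residue_primroot_def totient_prime)
  have "\<not> int p dvd int g"
    using cop assms(1) by (metis coprime_absorb_left int_dvd_int_iff not_prime_unit)
  moreover have "Legendre g p \<noteq> 1"
  proof
    assume "Legendre g p = 1"
    then have "[int g ^ ((p - 1) div 2) = 1] (mod p)"
      using euler_criterion[OF assms(1) p2, of g] by (simp add: cong_sym)
    then have "[g ^ ((p - 1) div 2) = 1] (mod p)"
      by (metis cong_int_iff of_nat_1 of_nat_power)
    then have "p - 1 dvd (p - 1) div 2"
      using ord ord_divides by metis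
    then show False
      using p2 by (auto dest!: dvd_imp_le)
  qed
  ultimately show ?thesis
    using Legendre_values[of g p] Legendre_eq_0_iff[of g p] by auto
qed

subsection \<open>The discrete Fourier transform modulo an odd prime\<close>

text \<open>The field may have characteristic 2, where \<open>\<chi>\<close> takes the same value on
  residues and nonresidues. Conditions on supports are therefore phrased with the integer-valued
  \<open>Legendre\<close>, not with \<open>\<chi>\<close>.\<close>

locale prime_unity_root =
  fixes p :: nat and \<zeta> :: "'b::field"
  assumes p: "prime p" "odd p"
    and \<zeta>: "\<zeta> ^ p = 1" "\<zeta> \<noteq> 1"
    and p_nonzero: "of_nat p \<noteq> (0::'b)"
begin

text \<open>The additive character of the integers modulo \<open>p\<close> given by \<zeta>.
  Reducing the argument first provides a natural exponent for negative arguments too.\<close>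

definition e :: "int \<Rightarrow> 'b" where "e k = \<zeta> ^ nat (k mod int p)"

definition \<chi> :: "int \<Rightarrow> 'b" where "\<chi> k = of_int (Legendre k p)"

text \<open>Inversion modulo \<open>p\<close>, by Fermat, extended by 0 on multiples of \<open>p\<close>.\<close>
definition iv :: "int \<Rightarrow> int" where "iv t = t ^ (p - 2)"

definition dft :: "(int \<Rightarrow> 'b) \<Rightarrow> int \<Rightarrow> 'b" where
  "dft v b = (\<Sum>t\<in>{0..<int p}. v t * e (b * t))"

definition periodic :: "(int \<Rightarrow> 'b) \<Rightarrow> bool" where
  "periodic v \<longleftrightarrow> (\<forall>t. v (t mod int p) = v t)"

lemma p_gt_2: "2 < p"
  using p prime_ge_2_nat[of p] by (cases "p = 2") auto

lemma \<zeta>_power_mod: "\<zeta> ^ (m mod p) = \<zeta> ^ m"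
proof -
  have "\<zeta> ^ m = \<zeta> ^ (p * (m div p) + m mod p)" by simp
  also have "\<dots> = \<zeta> ^ (m mod p)"
    by (simp only: power_add power_mult \<zeta>) simp
  finally show ?thesis ..
qed

lemma e_mod [simp]: "e (k mod int p) = e k"
  by (simp add: e_def)

lemma e_of_nat: "e (int m) = \<zeta> ^ m"
  using \<zeta>_power_mod[of m] by (simp add: e_def flip: of_nat_mod)

lemma e_0 [simp]: "e 0 = 1" by (simp add: e_def)

lemma e_add: "e (a + b) = e a * e b"
proof -
  define a' b' where "a' = nat (a mod int p)" and "b' = nat (b mod int p)"
  have *: "int a' = a mod p" "int b' = b mod p"
    using p_gt_2 by (auto simp: a'_def b'_def)
  have "e (a + b) = e ((a mod int p + b mod int p) mod int p)"
    by (simp add: mod_add_eq)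
  also have "\<dots> = e (int (a' + b'))" by (simp add: *)
  also have "\<dots> = e a * e b"
    unfolding e_of_nat power_add by (simp add: e_def a'_def b'_def)
  finally show ?thesis .
qed

lemma e_nonzero [simp]: "e k \<noteq> 0"
proof
  assume "e k = 0"
  moreover have "e k * e (- k) = 1" by (simp flip: e_add)
  ultimately show False by simp
qed

text \<open>An exponent prime to \<open>p\<close> can be inverted modulo \<open>p\<close>, so
  \<zeta> itself would be 1.\<close>

lemma \<zeta>_power_eq_1_iff: "\<zeta> ^ m = 1 \<longleftrightarrow> p dvd m"
proof
  assume m: "\<zeta> ^ m = 1"
  show "p dvd m"
  proof (rule ccontr)
    assume "\<not> p dvd m"
    then have "coprime m p" using p by (metis coprime_commute prime_imp_coprime)
    then obtain x where "[m * x = 1] (mod p)" using cong_solve_coprime_nat by auto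
    then have "\<zeta> ^ (m * x) = \<zeta> ^ 1"
      unfolding cong_def using \<zeta>_power_mod by metis
    moreover have "\<zeta> ^ (m * x) = 1" by (simp only: power_mult m power_one)
    ultimately show False using \<zeta> by simp
  qed
next
  assume "p dvd m"
  then obtain x where "m = p * x" ..
  then show "\<zeta> ^ m = 1" by (simp only: power_mult \<zeta> power_one)
qed

lemma e_eq_1_iff: "e k = 1 \<longleftrightarrow> int p dvd k"
proof -
  obtain m where m: "k mod int p = int m"
    using p_gt_2 by (metis pos_mod_sign of_nat_0_less_iff less_trans zero_less_numeral zero_le_imp_eq_int)
  then have "int p dvd k \<longleftrightarrow> p dvd m"
    by (metis dvd_mod_iff dvd_refl int_dvd_int_iff)
  then show ?thesis
    using \<zeta>_power_eq_1_iff[of m] by (simp add: e_def m)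
qed

section \<open>Permutations of the residues modulo \<open>p\<close>\<close>

lemma p_dvd_mult_iff: "int p dvd a * b \<longleftrightarrow> int p dvd a \<or> int p dvd b"
  using p by (simp add: prime_dvd_mult_iff)

lemma periodicD: "periodic F \<Longrightarrow> [a = b] (mod int p) \<Longrightarrow> F a = F b"
  unfolding periodic_def cong_def by metis

text \<open>A map that is injective modulo \<open>p\<close> permutes the finite set of residues.
  Translation, scaling and inversion of the summation variable all rest on this.\<close>

lemma sum_residues_reindex:
  assumes F: "periodic F"
    and inj: "\<And>s t. [f s = f t] (mod int p) \<Longrightarrow> [s = t] (mod int p)"
  shows "(\<Sum>t\<in>{0..<int p}. F (f t)) = (\<Sum>t\<in>{0..<int p}. F t)"
proof -
  define h where "h t = f t mod int p" for t
  have "inj_on h {0..<int p}"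
  proof (rule inj_onI)
    fix s t assume st: "s \<in> {0..<int p}" "t \<in> {0..<int p}" and "h s = h t"
    then have "[f s = f t] (mod int p)" by (simp add: cong_def h_def)
    then have "[s = t] (mod int p)" by (rule inj)
    with st show "s = t" by (simp add: cong_def)
  qed
  moreover have "h ` {0..<int p} \<subseteq> {0..<int p}"
    using p_gt_2 by (simp add: image_subset_iff h_def)
  ultimately have "bij_betw h {0..<int p} {0..<int p}"
    unfolding bij_betw_def by (simp add: endo_inj_surj)
  then have "(\<Sum>t\<in>{0..<int p}. F (h t)) = (\<Sum>t\<in>{0..<int p}. F t)"
    by (rule sum.reindex_bij_betw)
  moreover have "F (h t) = F (f t)" for t
    using F unfolding h_def periodic_def by blast
  ultimately show ?thesis by simp
qed

lemma sum_residues_shift: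
  "periodic F \<Longrightarrow> (\<Sum>t\<in>{0..<int p}. F (t + h)) = (\<Sum>t\<in>{0..<int p}. F t)"
  by (rule sum_residues_reindex[where f = "\<lambda>t. t + h"]) (simp_all add: cong_add_rcancel)

lemma cong_mult_cancel:
  assumes "\<not> int p dvd r"
  shows "[r * s = r * t] (mod int p) \<longleftrightarrow> [s = t] (mod int p)"
  using assms by (simp add: cong_iff_dvd_diff p_dvd_mult_iff flip: right_diff_distrib)

lemma sum_residues_scale:
  "periodic F \<Longrightarrow> \<not> int p dvd r \<Longrightarrow> (\<Sum>t\<in>{0..<int p}. F (r * t)) = (\<Sum>t\<in>{0..<int p}. F t)"
  by (rule sum_residues_reindex[where f = "(*) r"]) (simp_all add: cong_mult_cancel)

lemma iv_cong: "\<not> int p dvd t \<Longrightarrow> [t * iv t = 1] (mod int p)"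
proof -
  assume t: "\<not> int p dvd t"
  have "t * iv t = t ^ (p - 1)"
    using p_gt_2 by (simp add: iv_def flip: power_Suc) (simp add: numeral_2_eq_2 Suc_diff_Suc)
  moreover have "[nat (t mod int p) ^ (p - 1) = 1] (mod p)"
    using t p_gt_2 by (intro fermat_theorem p) (auto simp: dvd_mod_iff simp flip: int_dvd_int_iff)
  then have "[(t mod int p) ^ (p - 1) = 1] (mod int p)"
    using p_gt_2 by (simp flip: cong_int_iff)
  then have "[t ^ (p - 1) = 1] (mod int p)"
    by (simp add: cong_def power_mod)
  ultimately show ?thesis by simp
qed

lemma p_dvd_iv_iff: "int p dvd iv t \<longleftrightarrow> int p dvd t"
  unfolding iv_def using p p_gt_2 by (simp add: prime_dvd_power_iff)

lemma iv_congI: "[s = t] (mod int p) \<Longrightarrow> [iv s = iv t] (mod int p)"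
  unfolding iv_def by (rule cong_pow)

lemma iv_mult: "iv (s * t) = iv s * iv t"
  by (simp add: iv_def power_mult_distrib)

text \<open>This includes the multiples of \<open>p\<close>, where both sides are 0 modulo
  \<open>p\<close>. So \<open>iv\<close> is an involution on all residues, and substituting
  \<open>iv t\<close> in a sum need not treat 0 apart.\<close>

lemma iv_iv: "[iv (iv t) = t] (mod int p)"
proof (cases "int p dvd t")
  case True
  then have "int p dvd iv (iv t)" by (simp add: p_dvd_iv_iff)
  with True show ?thesis by (simp add: cong_iff_dvd_diff)
next
  case False
  have "[iv t * iv (iv t) = iv t * t] (mod int p)"
    using iv_cong[OF False] iv_cong[of "iv t"] False
    by (metis cong_sym cong_trans mult.commute p_dvd_iv_iff)
  then show ?thesis using False by (simp add: cong_mult_cancel p_dvd_iv_iff)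
qed

lemma iv_inj: "[iv s = iv t] (mod int p) \<Longrightarrow> [s = t] (mod int p)"
  by (meson cong_sym cong_trans iv_congI iv_iv)

section \<open>Orthogonality of characters and Fourier inversion\<close>

lemma sum_e: "(\<Sum>t\<in>{0..<int p}. e (k * t)) = (if int p dvd k then of_nat p else 0)"
proof (cases "int p dvd k")
  case True
  then have "e (k * t) = 1" for t by (simp add: e_eq_1_iff)
  then show ?thesis using True by simp
next
  case False
  let ?S = "\<Sum>t\<in>{0..<int p}. e (k * t)"
  \<comment> \<open>Translating the variable by 1 multiplies the sum by \<open>e k\<close>, which is
    not 1, yet leaves it unchanged; so the sum is 0.\<close>
  have "periodic (\<lambda>t. e (k * t))"
    unfolding periodic_def by (metis e_mod mod_mult_right_eq)
  from sum_residues_shift[OF this, of 1]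
  have "e k * ?S = ?S"
    by (simp add: algebra_simps e_add sum_distrib_left)
  then have "(e k - 1) * ?S = 0" by (simp add: algebra_simps)
  moreover have "e k \<noteq> 1" using False by (simp add: e_eq_1_iff)
  ultimately show ?thesis using False by simp
qed

lemma periodic_e [simp]: "periodic (\<lambda>t. e (k * t))"
  unfolding periodic_def by (metis e_mod mod_mult_right_eq)

text \<open>After exchanging the two sums, orthogonality leaves only the term
  \<open>s = t mod int p\<close>. The factor \<open>p\<close> is kept rather than divided
  out.\<close>

lemma dft_inversion:
  assumes "periodic v"
  shows "(\<Sum>b\<in>{0..<int p}. dft v b * e (- (b * t))) = of_nat p * v t"
proof -
  have "(\<Sum>b\<in>{0..<int p}. dft v b * e (- (b * t)))
      = (\<Sum>b\<in>{0..<int p}. \<Sum>s\<in>{0..<int p}. v s * e ((s - t) * b))"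
    unfolding dft_def sum_distrib_right
    by (intro sum.cong refl) (simp add: mult.assoc algebra_simps flip: e_add)
  also have "\<dots> = (\<Sum>s\<in>{0..<int p}. v s * (\<Sum>b\<in>{0..<int p}. e ((s - t) * b)))"
    by (subst sum.swap) (simp add: sum_distrib_left)
  also have "\<dots> = (\<Sum>s\<in>{0..<int p}. if s = t mod int p then v s * of_nat p else 0)"
  proof (intro sum.cong refl)
    fix s assume "s \<in> {0..<int p}"
    then have "int p dvd s - t \<longleftrightarrow> s = t mod int p"
      by (metis atLeastLessThan_iff mod_eq_dvd_iff mod_pos_pos_trivial)
    then show "v s * (\<Sum>b\<in>{0..<int p}. e ((s - t) * b)) = (if s = t mod int p then v s * of_nat p else 0)"
      by (simp add: sum_e)
  qed
  also have "\<dots> = v (t mod int p) * of_nat p"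
    using p_gt_2 by (subst sum.delta) auto
  finally show ?thesis using assms by (simp add: periodic_def mult.commute)
qed

lemma dft_0_imp_0:
  assumes "periodic v" "\<And>b. dft v b = 0"
  shows "v t = 0"
proof -
  have "of_nat p * v t = 0"
    using dft_inversion[OF assms(1), of t] by (simp add: assms(2))
  then show ?thesis using p_nonzero by simp
qed

lemma periodic_dft: "periodic (dft v)"
  unfolding periodic_def
proof
  fix b
  have "e (b mod int p * t) = e (b * t)" for t
    by (metis e_mod mod_mult_left_eq)
  then show "dft v (b mod int p) = dft v b"
    by (simp add: dft_def)
qed

section \<open>The quadratic character\<close>

lemma periodic_\<chi> [simp]: "periodic \<chi>"
  by (simp add: periodic_def \<chi>_def)

lemma \<chi>_mult: "\<chi> (a * b) = \<chi> a * \<chi> b"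
  by (simp add: \<chi>_def Legendre_mult p)

text \<open>\<open>iv\<close> is a power with the odd exponent \<open>p - 2\<close>, and odd powers
  fix a sign.\<close>

lemma Legendre_iv: "Legendre (iv t) p = Legendre t p"
proof (cases "int p dvd t")
  case True
  then show ?thesis using Legendre_eq_0_iff p_dvd_iv_iff by metis
next
  case False
  have "odd (p - 2)" using p p_gt_2 by simp
  then have "Legendre t p ^ (p - 2) = Legendre t p"
    using Legendre_values[of t p] p_gt_2 by auto
  then show ?thesis by (simp add: iv_def Legendre_power p)
qed

lemma ex_nonresidue: obtains r where "Legendre r p = -1"
proof -
  obtain g where "residue_primroot p g"
    using prime_primitive_root_exists[of p] p p_gt_2 by auto
  then show thesis using that Legendre_primroot p by blast
qed

section \<open>The square root bound for a spectrum that does not vanish at 0\<close>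

definition weight :: "(int \<Rightarrow> 'b) \<Rightarrow> nat" where
  "weight v = card {t \<in> {0..<int p}. v t \<noteq> 0}"

lemma periodic_mult: "periodic u \<Longrightarrow> periodic v \<Longrightarrow> periodic (\<lambda>t. u t * v t)"
  by (simp add: periodic_def)

lemma periodic_compose:
  assumes "periodic v" "\<And>t. [f (t mod int p) = f t] (mod int p)"
  shows "periodic (\<lambda>t. v (f t))"
  unfolding periodic_def using assms periodicD by blast

lemma periodic_affine: "periodic v \<Longrightarrow> periodic (\<lambda>t. v (r * t + h))"
  by (rule periodic_compose[where f = "\<lambda>t. r * t + h"]) (assumption, intro cong_add cong_mult cong_refl, simp)

lemma dft_0_only_const:
  assumes "periodic v" "\<And>b. \<not> int p dvd b \<Longrightarrow> dft v b = 0"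
  shows "of_nat p * v t = dft v 0"
proof -
  have "dft v b * e (- (b * t)) = (if b = 0 then dft v 0 else 0)" if "b \<in> {0..<int p}" for b
    using that assms(2)[of b] zdvd_not_zless[of b "int p"] by (cases "b = 0") auto
  then have "(\<Sum>b\<in>{0..<int p}. dft v b * e (- (b * t))) = (\<Sum>b\<in>{0..<int p}. if b = 0 then dft v 0 else 0)"
    by (intro sum.cong) auto
  then show ?thesis
    using dft_inversion[OF assms(1), of t] p_gt_2 by simp
qed

text \<open>The convolution theorem for \<open>v\<close> and its dilation by \<open>r\<close>.
  Substituting \<open>r * t\<close> moves the dilation to the frequency, where it becomes
  multiplication by the inverse \<open>r'\<close>.\<close>

lemma dft_scaled_convolution:
  assumes v: "periodic v" and r: "[r' * r = 1] (mod int p)"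
  shows "dft (\<lambda>t. \<Sum>s\<in>{0..<int p}. v s * v (r * (t - s))) k = dft v k * dft v (k * r')"
proof -
  have nr: "\<not> int p dvd r"
  proof
    assume "int p dvd r"
    then have "int p dvd 1"
      using r by (metis cong_dvd_iff dvd_mult)
    then show False using p_gt_2 by simp
  qed
  have inner: "(\<Sum>t\<in>{0..<int p}. v (r * (t - s)) * e (k * (t - s))) = dft v (k * r')" for s
  proof -
    have "(\<Sum>t\<in>{0..<int p}. v (r * (t - s)) * e (k * (t - s)))
        = (\<Sum>t\<in>{0..<int p}. v (r * t) * e (k * t))"
      using sum_residues_shift[of "\<lambda>t. v (r * t) * e (k * t)" "-s"] periodic_affine[OF v, of r 0]
      by (simp add: periodic_mult)
    also have "\<dots> = (\<Sum>t\<in>{0..<int p}. v (r * t) * e (k * r' * (r * t)))"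
    proof (intro sum.cong refl)
      fix t
      have "[k * t * (r' * r) = k * t * 1] (mod int p)"
        by (intro cong_mult cong_refl r)
      then have "[k * t = k * r' * (r * t)] (mod int p)"
        by (simp add: ac_simps cong_sym)
      then have "e (k * t) = e (k * r' * (r * t))"
        unfolding cong_def by (metis e_mod)
      then show "v (r * t) * e (k * t) = v (r * t) * e (k * r' * (r * t))" by simp
    qed
    also have "\<dots> = dft v (k * r')"
      unfolding dft_def by (rule sum_residues_scale) (simp_all add: periodic_mult v nr)
    finally show ?thesis .
  qed
  have "dft (\<lambda>t. \<Sum>s\<in>{0..<int p}. v s * v (r * (t - s))) k
      = (\<Sum>t\<in>{0..<int p}. \<Sum>s\<in>{0..<int p}. v s * e (k * s) * (v (r * (t - s)) * e (k * (t - s))))"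
    unfolding dft_def sum_distrib_right
  proof (intro sum.cong refl)
    fix t s
    have "e (k * t) = e (k * s) * e (k * (t - s))"
      by (simp add: algebra_simps flip: e_add)
    then show "v s * v (r * (t - s)) * e (k * t) = v s * e (k * s) * (v (r * (t - s)) * e (k * (t - s)))"
      by simp
  qed
  also have "\<dots> = (\<Sum>s\<in>{0..<int p}. v s * e (k * s) * dft v (k * r'))"
    by (subst sum.swap) (simp add: inner flip: sum_distrib_left)
  also have "\<dots> = dft v k * dft v (k * r')"
    by (simp add: dft_def sum_distrib_right)
  finally show ?thesis .
qed

text \<open>Multiplication by a nonresidue exchanges the two quadratic classes. Hence, off the
  multiples of \<open>p\<close>, the spectra of \<open>v\<close> and of its dilation have disjoint
  supports, and the convolution is a constant, nonzero because \<open>dft v 0\<close> is.\<close>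

lemma weight_bound_odd_like:
  assumes v: "periodic v" and "dft v 0 \<noteq> 0"
    and supp: "\<And>b. dft v b \<noteq> 0 \<Longrightarrow> int p dvd b \<or> Legendre b p = \<epsilon>"
  shows "p \<le> (weight v)\<^sup>2"
proof -
  obtain r where r: "Legendre r p = -1" by (rule ex_nonresidue)
  then have nr: "\<not> int p dvd r" by (metis Legendre_eq_0_iff neg_equal_0_iff_equal one_neq_zero)
  have inv: "[iv r * r = 1] (mod int p)"
    using iv_cong[OF nr] by (simp add: mult.commute)
  define y where "y t = (\<Sum>s\<in>{0..<int p}. v s * v (r * (t - s)))" for t
  have y: "periodic y"
    unfolding periodic_def y_def
  proof (intro allI sum.cong refl)
    fix t s
    have "v (r * (t mod int p - s)) = v (r * (t - s))"
      by (rule periodicD[OF v], intro cong_mult cong_diff cong_refl) simp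
    then show "v s * v (r * (t mod int p - s)) = v s * v (r * (t - s))" by simp
  qed
  have "dft y = (\<lambda>k. dft v k * dft v (k * iv r))"
    unfolding y_def using dft_scaled_convolution[OF v inv] by blast
  moreover have "dft v k * dft v (k * iv r) = 0" if "\<not> int p dvd k" for k
  proof (rule ccontr)
    assume "dft v k * dft v (k * iv r) \<noteq> 0"
    then have "Legendre k p = \<epsilon>" "Legendre (k * iv r) p = \<epsilon>"
      using supp[of k] supp[of "k * iv r"] that nr by (auto simp: p_dvd_mult_iff p_dvd_iv_iff)
    moreover have "Legendre (k * iv r) p = - Legendre k p"
      using r by (simp add: Legendre_mult p Legendre_iv)
    moreover have "Legendre k p \<noteq> 0" using that by (simp add: Legendre_eq_0_iff)
    ultimately show False by simp
  qed
  ultimately have "of_nat p * y t = dft v 0 * dft v 0" for t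
    using dft_0_only_const[OF y] by simp
  then have y_nz: "y t \<noteq> 0" for t
    using assms(2) by (metis mult_eq_0_iff)
  define X where "X = {t \<in> {0..<int p}. v t \<noteq> 0}"
  \<comment> \<open>As \<open>y\<close> vanishes nowhere, each \<open>t\<close> has a nonzero term
    in its convolution sum, which writes \<open>t\<close> as \<open>s + iv r * s'\<close> with
    \<open>s\<close> and \<open>s'\<close> in the support \<open>X\<close>. Thus
    \<open>X \<times> X\<close> maps onto all \<open>p\<close> residues.\<close>
  have "{0..<int p} \<subseteq> (\<lambda>(s, t). (s + iv r * t) mod int p) ` (X \<times> X)"
  proof
    fix t assume t: "t \<in> {0..<int p}"
    obtain s where s: "s \<in> {0..<int p}" "v s * v (r * (t - s)) \<noteq> 0"
      using y_nz[of t] unfolding y_def by (meson sum.neutral)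
    define s' where "s' = (r * (t - s)) mod int p"
    have "[s + iv r * s' = s + iv r * (r * (t - s))] (mod int p)"
      unfolding s'_def by (intro cong_add cong_mult cong_refl) simp
    then have "(s + iv r * s') mod int p = (s + iv r * r * (t - s)) mod int p"
      by (simp add: cong_def mult.assoc)
    also have "[s + iv r * r * (t - s) = s + 1 * (t - s)] (mod int p)"
      by (intro cong_add cong_mult cong_refl inv)
    then have "(s + iv r * r * (t - s)) mod int p = t"
      using t by (simp add: cong_def)
    finally have "(s + iv r * s') mod int p = t" .
    moreover have "s \<in> X" "s' \<in> X"
      using s v p_gt_2 by (auto simp: X_def s'_def periodic_def)
    ultimately show "t \<in> (\<lambda>(s, t). (s + iv r * t) mod int p) ` (X \<times> X)"
      by (auto intro!: image_eqI[of _ _ "(s, s')"])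
  qed
  moreover have "finite X" unfolding X_def by (rule finite_subset[of _ "{0..<int p}"]) auto
  ultimately have "card {0..<int p} \<le> card (X \<times> X)"
    by (meson card_image_le card_mono finite_SigmaI finite_imageI le_trans)
  then show ?thesis
    by (simp add: weight_def X_def power2_eq_square card_cartesian_product)
qed

section \<open>Salie sums and the Gauss sum\<close>

lemma \<chi>_cases:
  "\<chi> t = (if Legendre t p = 1 then 1 else 0) - (if Legendre t p = -1 then 1 else 0)"
  using Legendre_values[of t p] by (auto simp: \<chi>_def)

lemma Legendre_minus: "Legendre (- a) p = Legendre (-1) p * Legendre a p"
  using Legendre_mult[OF p, of "-1" a] by simp

lemma iv_minus: "iv (- t) = - iv t"
  using p p_gt_2 by (simp add: iv_def)

lemma salie_sum_eq_0:
  assumes "Legendre (- (k * b)) p = -1"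
  shows "(\<Sum>t\<in>{0..<int p}. \<chi> t * e (k * t - b * iv t)) = 0"
proof -
  have "\<not> int p dvd - (k * b)"
    using assms by (metis Legendre_eq_0_iff neg_equal_0_iff_equal one_neq_zero)
  then have nk: "\<not> int p dvd k" and nb: "\<not> int p dvd b" by auto
  \<comment> \<open>Chosen so that \<open>k * f t\<close> is \<open>- b * iv t\<close> and
    \<open>b * iv (f t)\<close> is \<open>- k * t\<close> modulo \<open>p\<close>: the two summands
    of the exponent change places. The symbol of \<open>t\<close> is multiplied by that of
    \<open>- (k * b)\<close>, hence changes sign.\<close>
  define f where "f t = - (b * iv k) * iv t" for t
  define G where "G \<epsilon> t = (if Legendre t p = \<epsilon> then e (k * t - b * iv t) else 0)" for \<epsilon> t
  have per: "periodic (G \<epsilon>)" for \<epsilon>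
    unfolding periodic_def
  proof
    fix t
    have "[k * (t mod int p) - b * iv (t mod int p) = k * t - b * iv t] (mod int p)"
      by (intro cong_diff cong_mult cong_refl iv_congI) simp_all
    then have "e (k * (t mod int p) - b * iv (t mod int p)) = e (k * t - b * iv t)"
      unfolding cong_def by (metis e_mod)
    then show "G \<epsilon> (t mod int p) = G \<epsilon> t" by (simp add: G_def)
  qed
  text \<open>The involution \<open>f\<close> swaps the terms of the two sums over residues and nonresidues. (Writing the
    sum as its own negative would not suffice in characteristic 2.)\<close>
  have G_f: "G 1 (f t) = G (-1) t" for t
  proof -
    have "k * f t = k * iv k * - (b * iv t)" by (simp add: f_def)
    also have "[\<dots> = 1 * - (b * iv t)] (mod int p)"
      by (intro cong_mult cong_refl iv_cong nk)
    finally have 1: "[k * f t = - (b * iv t)] (mod int p)" by simp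
    have "b * iv (f t) = b * iv b * (- 1 * (iv (iv k) * iv (iv t)))"
      by (simp add: f_def iv_mult iv_minus)
    also have "[\<dots> = 1 * (- 1 * (k * t))] (mod int p)"
      by (intro cong_mult cong_refl iv_cong nb iv_iv)
    finally have 2: "[b * iv (f t) = - (k * t)] (mod int p)" by simp
    have "e (k * f t - b * iv (f t)) = e (k * t - b * iv t)"
    proof -
      have "e (k * f t - b * iv (f t)) = e (- (b * iv t) - - (k * t))"
        using cong_diff[OF 1 2] unfolding cong_def by (metis e_mod)
      then show ?thesis by simp
    qed
    moreover have "Legendre (f t) p = Legendre (- (k * b)) p * Legendre t p"
      using Legendre_minus[of "k * b"] Legendre_minus[of "b * iv k * iv t"]
      by (simp add: f_def Legendre_mult Legendre_iv p)
    ultimately show ?thesis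
      using assms by (simp add: G_def)
  qed
  have "(\<Sum>t\<in>{0..<int p}. G 1 (f t)) = (\<Sum>t\<in>{0..<int p}. G 1 t)"
  proof (rule sum_residues_reindex[OF per])
    fix s t assume "[f s = f t] (mod int p)"
    then have "[iv s = iv t] (mod int p)"
      unfolding f_def using nk nb by (subst (asm) cong_mult_cancel) (auto simp: p_dvd_mult_iff p_dvd_iv_iff)
    then show "[s = t] (mod int p)" by (rule iv_inj)
  qed
  moreover have "\<chi> t * e (k * t - b * iv t) = G 1 t - G (-1) t" for t
    by (simp add: \<chi>_cases G_def)
  ultimately show ?thesis
    by (simp add: G_f sum_subtractf)
qed

lemma \<chi>_square: "\<not> int p dvd b \<Longrightarrow> \<chi> b * \<chi> b = 1"
  using Legendre_values[of b p] Legendre_eq_0_iff[of b p] by (auto simp: \<chi>_def)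

text \<open>Substitute \<open>b * t\<close> for the variable; \<open>\<chi> b\<close> is its own
  inverse.\<close>

lemma dft_\<chi>:
  assumes "\<not> int p dvd b"
  shows "dft \<chi> b = \<chi> b * dft \<chi> 1"
proof -
  have "\<chi> t * e (b * t) = \<chi> b * (\<chi> (b * t) * e (1 * (b * t)))" for t
  proof -
    have "\<chi> b * (\<chi> (b * t) * e (1 * (b * t))) = (\<chi> b * \<chi> b) * (\<chi> t * e (b * t))"
      by (simp add: \<chi>_mult)
    then show ?thesis by (simp add: \<chi>_square assms)
  qed
  then have "dft \<chi> b = \<chi> b * (\<Sum>t\<in>{0..<int p}. \<chi> (b * t) * e (1 * (b * t)))"
    by (simp only: dft_def sum_distrib_left)
  also have "(\<Sum>t\<in>{0..<int p}. \<chi> (b * t) * e (1 * (b * t))) = dft \<chi> 1"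
    unfolding dft_def using assms by (intro sum_residues_scale periodic_mult periodic_\<chi> periodic_e)
  finally show ?thesis .
qed

text \<open>Otherwise the transform of \<open>\<chi>\<close> would vanish off the multiples of
  \<open>p\<close> and \<open>\<chi>\<close> would be constant, but \<open>\<chi> 0 = 0\<close>
  while \<open>\<chi> 1\<close> is not 0. No evaluation of the square of the Gauss sum is
  involved.\<close>

lemma gauss_sum_nonzero: "dft \<chi> 1 \<noteq> 0"
proof
  assume G: "dft \<chi> 1 = 0"
  have "of_nat p * \<chi> t = dft \<chi> 0" for t
    by (rule dft_0_only_const[OF periodic_\<chi>]) (metis G dft_\<chi> mult_zero_right)
  then have "of_nat p * \<chi> 0 = of_nat p * \<chi> 1" by simp
  then have "\<chi> 0 = \<chi> 1" using p_nonzero by simp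
  moreover have "\<chi> 0 = 0" by (simp add: \<chi>_def Legendre_def)
  moreover have "\<chi> 1 * \<chi> 1 = 1" using p_gt_2 by (intro \<chi>_square) simp
  ultimately show False by simp
qed

section \<open>The Gleason-Prange transformation\<close>

definition gleason_prange :: "(int \<Rightarrow> 'b) \<Rightarrow> int \<Rightarrow> 'b" where
  "gleason_prange v t = \<chi> t * v (iv t)"

lemma periodic_gleason_prange: "periodic v \<Longrightarrow> periodic (gleason_prange v)"
  unfolding gleason_prange_def
  by (intro periodic_mult periodic_\<chi>, erule periodic_compose[where f = iv], intro iv_congI) simp

text \<open>Expanding \<open>v (iv t)\<close> by Fourier inversion produces Salie sums, weighted by
  the old spectrum.\<close>

lemma dft_gleason_prange:
  assumes "periodic v"
  shows "of_nat p * dft (gleason_prange v) k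
       = (\<Sum>b\<in>{0..<int p}. dft v b * (\<Sum>t\<in>{0..<int p}. \<chi> t * e (k * t - b * iv t)))"
proof -
  have "of_nat p * dft (gleason_prange v) k
      = (\<Sum>t\<in>{0..<int p}. \<chi> t * (of_nat p * v (iv t)) * e (k * t))"
    by (simp add: dft_def gleason_prange_def sum_distrib_left mult_ac)
  also have "\<dots> = (\<Sum>t\<in>{0..<int p}. \<Sum>b\<in>{0..<int p}. dft v b * (\<chi> t * e (k * t - b * iv t)))"
    unfolding dft_inversion[OF assms, symmetric] sum_distrib_left sum_distrib_right
  proof (intro sum.cong refl)
    fix t b
    have "e (k * t - b * iv t) = e (k * t) * e (- (b * iv t))"
      by (simp flip: e_add)
    then show "\<chi> t * (dft v b * e (- (b * iv t))) * e (k * t) = dft v b * (\<chi> t * e (k * t - b * iv t))"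
      by (simp add: mult_ac)
  qed
  finally show ?thesis
    by (subst (asm) sum.swap) (simp add: sum_distrib_left)
qed

text \<open>For \<open>k\<close> prime to \<open>p\<close> and outside the claimed class,
  \<open>- (k * b)\<close> is a nonresidue for every \<open>b\<close> in the old support, so each
  Salie sum vanishes. The term at \<open>b = 0\<close> would be a nonzero Gauss sum;
  \<open>dft v 0 = 0\<close> removes it.\<close>

lemma dft_gleason_prange_support:
  assumes v: "periodic v" "dft v 0 = 0"
    and supp: "\<And>b. dft v b \<noteq> 0 \<Longrightarrow> int p dvd b \<or> Legendre b p = \<epsilon>"
    and \<epsilon>: "\<epsilon> = 1 \<or> \<epsilon> = -1"
    and k: "dft (gleason_prange v) k \<noteq> 0"
  shows "int p dvd k \<or> Legendre k p = \<epsilon> * Legendre (-1) p"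
proof (rule ccontr)
  assume *: "\<not> (int p dvd k \<or> Legendre k p = \<epsilon> * Legendre (-1) p)"
  have "dft v b * (\<Sum>t\<in>{0..<int p}. \<chi> t * e (k * t - b * iv t)) = 0" if "b \<in> {0..<int p}" for b
  proof (cases "dft v b = 0")
    case False
    with v(2) that have "\<not> int p dvd b"
      using zdvd_not_zless[of b "int p"] by (cases "b = 0") auto
    with supp[OF False] have "Legendre b p = \<epsilon>" by simp
    moreover have "Legendre (- (k * b)) p = Legendre (-1) p * (Legendre k p * Legendre b p)"
      by (simp only: Legendre_minus[of "k * b"] Legendre_mult[OF p])
    moreover have "Legendre (-1) p \<noteq> 0" "Legendre k p \<noteq> 0"
      using * p_gt_2 by (auto simp: Legendre_eq_0_iff)
    ultimately have "Legendre (- (k * b)) p = -1"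
      using * \<epsilon> Legendre_values[of "-1" p] Legendre_values[of k p] by auto
    then show ?thesis by (simp add: salie_sum_eq_0)
  qed simp
  then have "of_nat p * dft (gleason_prange v) k = 0"
    unfolding dft_gleason_prange[OF v(1)] by (rule sum.neutral[OF ballI])
  with k p_nonzero show False by simp
qed

text \<open>The value \<open>v 0\<close>, which \<open>gleason_prange v\<close> drops because
  \<open>\<chi> 0 = 0\<close>, reappears as its transform at 0. Indeed, for \<open>k = 0\<close> the
  Salie sums become the Gauss sums \<open>dft \<chi> (- b)\<close>, which are equal for all
  \<open>b\<close> in the single class of the support, and inversion at 0 sums up the rest.\<close>

lemma dft_gleason_prange_0:
  assumes v: "periodic v" "dft v 0 = 0" "v 0 \<noteq> 0"
    and supp: "\<And>b. dft v b \<noteq> 0 \<Longrightarrow> int p dvd b \<or> Legendre b p = \<epsilon>"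
    and \<epsilon>: "\<epsilon> = 1 \<or> \<epsilon> = -1"
  shows "dft (gleason_prange v) 0 \<noteq> 0"
proof -
  \<comment> \<open>The common value of \<open>dft \<chi> (- b)\<close> on the support of
    \<open>dft v\<close>.\<close>
  define c where "c = \<chi> (-1) * of_int \<epsilon> * dft \<chi> 1"
  have inner: "(\<Sum>t\<in>{0..<int p}. \<chi> t * e (0 * t - b * iv t)) = dft \<chi> (- b)" for b
  proof -
    have "(\<Sum>t\<in>{0..<int p}. \<chi> (iv t) * e (- b * iv t)) = dft \<chi> (- b)"
      unfolding dft_def
      by (rule sum_residues_reindex[OF periodic_mult[OF periodic_\<chi> periodic_e]]) (rule iv_inj)
    moreover have "\<chi> (iv t) = \<chi> t" for t by (simp add: \<chi>_def Legendre_iv)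
    ultimately show ?thesis by simp
  qed
  have "dft v b * dft \<chi> (- b) = c * (dft v b * e (- (b * 0)))" if "b \<in> {0..<int p}" for b
  proof (cases "dft v b = 0")
    case False
    with v(2) that have nb: "\<not> int p dvd b"
      using zdvd_not_zless[of b "int p"] by (cases "b = 0") auto
    with supp[OF False] have "\<chi> b = of_int \<epsilon>" by (simp add: \<chi>_def)
    moreover have "dft \<chi> (- b) = \<chi> (-1) * \<chi> b * dft \<chi> 1"
      using dft_\<chi>[of "-b"] nb \<chi>_mult[of "-1" b] by simp
    ultimately show ?thesis by (simp add: c_def)
  qed simp
  then have "of_nat p * dft (gleason_prange v) 0 = (\<Sum>b\<in>{0..<int p}. c * (dft v b * e (- (b * 0))))"
    unfolding dft_gleason_prange[OF v(1)] inner by (rule sum.cong[OF refl])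
  also have "\<dots> = c * (of_nat p * v 0)"
    using dft_inversion[OF v(1), of 0] by (simp only: flip: sum_distrib_left)
  finally have "of_nat p * dft (gleason_prange v) 0 = c * (of_nat p * v 0)" .
  moreover have "\<chi> (-1) \<noteq> 0"
    using \<chi>_square[of "-1"] p_gt_2 by auto
  then have "c \<noteq> 0"
    using \<epsilon> gauss_sum_nonzero by (auto simp: c_def)
  ultimately show ?thesis using v(3) p_nonzero by auto
qed

section \<open>The square root bound in general\<close>

lemma weight_reindex_le:
  assumes v: "periodic v"
    and inj: "\<And>s t. [f s = f t] (mod int p) \<Longrightarrow> [s = t] (mod int p)"
    and w: "\<And>t. w t \<noteq> 0 \<Longrightarrow> v (f t) \<noteq> 0"
  shows "weight w \<le> weight v"
  unfolding weight_def
proof (rule card_inj_on_le[where f = "\<lambda>t. f t mod int p"])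
  show "inj_on (\<lambda>t. f t mod int p) {t \<in> {0..<int p}. w t \<noteq> 0}"
  proof (rule inj_onI)
    fix s t
    assume st: "s \<in> {t \<in> {0..<int p}. w t \<noteq> 0}" "t \<in> {t \<in> {0..<int p}. w t \<noteq> 0}"
      and "f s mod int p = f t mod int p"
    then have "[f s = f t] (mod int p)" by (simp add: cong_def)
    then have "[s = t] (mod int p)" by (rule inj)
    with st show "s = t" by (simp add: cong_def)
  qed
  show "(\<lambda>t. f t mod int p) ` {t \<in> {0..<int p}. w t \<noteq> 0} \<subseteq> {t \<in> {0..<int p}. v t \<noteq> 0}"
    using v w p_gt_2 by (auto simp: periodic_def)
qed (rule finite_subset[of _ "{0..<int p}"], auto)

theorem weight_bound:
  assumes v: "periodic v" "v t0 \<noteq> 0"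
    and supp: "\<And>b. dft v b \<noteq> 0 \<Longrightarrow> int p dvd b \<or> Legendre b p = \<epsilon>"
  shows "p \<le> (weight v)\<^sup>2"
proof (cases "dft v 0 = 0")
  case False
  then show ?thesis using weight_bound_odd_like v(1) supp by blast
next
  case True
  define u where "u t = v (t + t0)" for t
  have u: "periodic u" "u 0 \<noteq> 0"
    using periodic_affine[OF v(1), of 1 t0] v(2) by (simp_all add: u_def[abs_def])
  \<comment> \<open>Translation multiplies the spectrum by values of \<open>e\<close>, which are
    nonzero, so the support is preserved.\<close>
  have dft_u: "dft u b = e (- (b * t0)) * dft v b" for b
  proof -
    have "dft v b = (\<Sum>t\<in>{0..<int p}. v (t + t0) * e (b * (t + t0)))"
      unfolding dft_def using v(1)
      by (intro sum_residues_shift[symmetric] periodic_mult periodic_e)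
    also have "\<dots> = e (b * t0) * dft u b"
      by (simp add: dft_def u_def algebra_simps e_add sum_distrib_left)
    finally have "e (- (b * t0)) * dft v b = e (- (b * t0)) * e (b * t0) * dft u b" by simp
    then show ?thesis by (simp flip: e_add)
  qed
  then have u0: "dft u 0 = 0" and supp_u: "\<And>b. dft u b \<noteq> 0 \<Longrightarrow> int p dvd b \<or> Legendre b p = \<epsilon>"
    using True supp by auto
  \<comment> \<open>Some frequency carries the nonzero function \<open>u\<close>, and it is not a
    multiple of \<open>p\<close> because \<open>dft u 0 = 0\<close>. Its symbol is \<epsilon>, so
    \<epsilon> is a sign.\<close>
  obtain b where b: "dft u b \<noteq> 0" using dft_0_imp_0[OF u(1)] u(2) by blast
  have "dft u (b mod int p) = dft u b" using periodic_dft by (simp add: periodic_def)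
  with b u0 have "\<not> int p dvd b" by (metis dvd_imp_mod_0)
  with supp_u[OF b] have \<epsilon>: "\<epsilon> = 1 \<or> \<epsilon> = -1"
    using Legendre_values[of b p] Legendre_eq_0_iff[of b p] by auto
  have "p \<le> (weight (gleason_prange u))\<^sup>2"
    by (rule weight_bound_odd_like[OF periodic_gleason_prange[OF u(1)]])
      (use dft_gleason_prange_0[OF u(1) u0 u(2) supp_u \<epsilon>]
        dft_gleason_prange_support[OF u(1) u0 supp_u \<epsilon>] in blast)+
  moreover have "weight (gleason_prange u) \<le> weight u"
    by (rule weight_reindex_le[OF u(1), where f = iv]) (auto simp: gleason_prange_def iv_inj)
  moreover have "weight u \<le> weight v"
    by (rule weight_reindex_le[OF v(1), where f = "\<lambda>t. t + t0"]) (auto simp: u_def cong_add_rcancel)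
  ultimately show ?thesis
    by (meson le_trans power_mono zero_le)
qed

end

subsection \<open>Finite fields and cyclic codes\<close>

lemma power_diff_eq_1:
  fixes x :: "'a::field"
  assumes "x \<noteq> 0" "a \<le> b" "x ^ a = x ^ b"
  shows "x ^ (b - a) = 1"
  using assms by (simp add: power_diff)

text \<open>Being primitive only says that the powers cover all nonzero elements. With
  \<open>m\<close> the least positive exponent giving 1, the powers below \<open>m\<close> are
  distinct and already cover them, so counting yields \<open>m = CARD('b) - 1\<close>.\<close>

lemma primitive_element_power_eq_1_iff:
  fixes \<alpha> :: "'b::{finite,field}"
  assumes prim: "primitive_element \<alpha>" and "\<alpha> \<noteq> 0"
  shows "\<alpha> ^ k = 1 \<longleftrightarrow> CARD('b) - 1 dvd k"
proof -
  have "\<not> inj (\<lambda>k::nat. \<alpha> ^ k)"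
    using finite_imageD[of "\<lambda>k. \<alpha> ^ k" "UNIV :: nat set"] by auto
  then obtain a b :: nat where "a < b" "\<alpha> ^ a = \<alpha> ^ b"
    unfolding inj_def by (metis linorder_neqE_nat)
  then have ex: "\<exists>m>0. \<alpha> ^ m = 1"
    using power_diff_eq_1[OF \<open>\<alpha> \<noteq> 0\<close>, of a b] by (intro exI[of _ "b - a"]) simp
  define m where "m = (LEAST m. 0 < m \<and> \<alpha> ^ m = 1)"
  have m: "0 < m" "\<alpha> ^ m = 1"
    using LeastI_ex[OF ex] by (auto simp: m_def)
  have least: "k = 0" if "k < m" "\<alpha> ^ k = 1" for k
    using not_less_Least[of k "\<lambda>m. 0 < m \<and> \<alpha> ^ m = 1"] that by (auto simp: m_def)
  have mod: "\<alpha> ^ k = \<alpha> ^ (k mod m)" for k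
  proof -
    have "\<alpha> ^ k = \<alpha> ^ (m * (k div m) + k mod m)" by simp
    also have "\<dots> = \<alpha> ^ (k mod m)" by (simp only: power_add power_mult m) simp
    finally show ?thesis .
  qed
  have "inj_on (\<lambda>k. \<alpha> ^ k) {..<m}"
  proof (rule linorder_inj_onI')
    fix a b assume ab: "a \<in> {..<m}" "b \<in> {..<m}" "a < b"
    show "\<alpha> ^ a \<noteq> \<alpha> ^ b"
    proof
      assume "\<alpha> ^ a = \<alpha> ^ b"
      then have "\<alpha> ^ (b - a) = 1"
        using ab \<open>\<alpha> \<noteq> 0\<close> by (intro power_diff_eq_1) auto
      then show False using least[of "b - a"] ab by (simp add: less_imp_diff_less)
    qed
  qed
  moreover have "(\<lambda>k. \<alpha> ^ k) ` {..<m} = UNIV - {0}"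
  proof (intro equalityI subsetI)
    fix x :: 'b assume "x \<in> UNIV - {0}"
    then obtain k where "x = \<alpha> ^ k" using prim by (auto simp: primitive_element_def)
    then have "x = \<alpha> ^ (k mod m)" "k mod m < m" using mod m by auto
    then show "x \<in> (\<lambda>k. \<alpha> ^ k) ` {..<m}" by blast
  qed (use \<open>\<alpha> \<noteq> 0\<close> in auto)
  ultimately have "card (UNIV - {0 :: 'b}) = m"
    using card_image by (metis card_lessThan)
  then have "m = CARD('b) - 1" by (simp add: card_Diff_singleton)
  moreover have "\<alpha> ^ k = 1 \<longleftrightarrow> m dvd k"
    using mod[of k] least[of "k mod m"] m by (auto simp: mod_eq_0_iff_dvd)
  ultimately show ?thesis by simp
qed

text \<open>The translation by 1 permutes the ring, so it does not change the sum of all elements,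
  although it adds 1 to each of them.\<close>

lemma of_nat_card_eq_0: "of_nat (CARD('b)) = (0 :: 'b::{finite,ring_1})"
proof -
  have "(\<Sum>x\<in>UNIV. x + 1) = (\<Sum>x\<in>UNIV. x :: 'b)"
    by (rule sum.reindex_bij_witness[of _ "\<lambda>x. x - 1" "\<lambda>x. x + 1"]) auto
  then show ?thesis by (simp add: sum.distrib)
qed

text \<open>The characteristic divides the order of the field, so an inverse of \<open>m\<close>
  modulo the order is also an inverse modulo the characteristic.\<close>

lemma of_nat_nonzero_if_coprime_card:
  assumes "coprime m (CARD('b))"
  shows "of_nat m \<noteq> (0 :: 'b::{finite,field})"
proof
  assume m: "of_nat m = (0 :: 'b)"
  obtain x where "[m * x = 1] (mod CARD('b))"
    using cong_solve_coprime_nat[OF assms] by auto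
  then have "CHAR('b) dvd CARD('b) \<Longrightarrow> of_nat (m * x) = (of_nat 1 :: 'b)"
    by (subst of_nat_eq_iff_cong_CHAR) (rule cong_dvd_modulus_nat)
  moreover have "CHAR('b) dvd CARD('b)"
    by (simp add: of_nat_card_eq_0 flip: of_nat_eq_0_iff_char_dvd)
  ultimately show False using m by simp
qed

section \<open>Polynomials under a field embedding\<close>

lemma field_embedding_0: "field_embedding f \<Longrightarrow> f 0 = 0"
  unfolding field_embedding_def by (metis add_cancel_right_left)

lemma field_embedding_eq_0_iff: "field_embedding f \<Longrightarrow> f x = 0 \<longleftrightarrow> x = 0"
  using field_embedding_0[of f] by (metis field_embedding_def injD)

lemma field_embedding_sum:
  "field_embedding f \<Longrightarrow> f (\<Sum>x\<in>A. h x) = (\<Sum>x\<in>A. f (h x))"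
  by (induction A rule: infinite_finite_induct)
    (simp_all add: field_embedding_0, simp add: field_embedding_def)

lemma map_poly_embedding_add:
  "field_embedding f \<Longrightarrow> map_poly f (p + q) = map_poly f p + map_poly f q"
  by (rule poly_eqI) (simp add: coeff_map_poly field_embedding_0, simp add: field_embedding_def)

lemma map_poly_embedding_mult:
  assumes "field_embedding f"
  shows "map_poly f (p * q) = map_poly f p * map_poly f q"
proof (rule poly_eqI)
  have "f (x * y) = f x * f y" for x y using assms by (simp add: field_embedding_def)
  then show "coeff (map_poly f (p * q)) k = coeff (map_poly f p * map_poly f q) k" for k
    by (simp add: coeff_map_poly field_embedding_0 field_embedding_sum assms coeff_mult)
qed

lemma map_poly_embedding_eq_0_iff: "field_embedding f \<Longrightarrow> map_poly f p = 0 \<longleftrightarrow> p = 0"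
  by (simp add: poly_eq_iff coeff_map_poly field_embedding_0 field_embedding_eq_0_iff)

lemma degree_map_poly_embedding: "field_embedding f \<Longrightarrow> degree (map_poly f p) = degree p"
  by (simp add: degree_map_poly field_embedding_eq_0_iff)

lemma map_poly_embedding_diff:
  assumes "field_embedding f"
  shows "map_poly f (p - q) = map_poly f p - map_poly f q"
  using map_poly_embedding_add[OF assms, of "p - q" q] by simp

lemma map_poly_embedding_monom_diff_1:
  "field_embedding f \<Longrightarrow> map_poly f (monom 1 n - 1) = monom 1 n - 1"
  by (simp add: map_poly_embedding_diff map_poly_monom field_embedding_0)
    (simp add: field_embedding_def)

text \<open>Divisibility descends to the subfield: division with remainder is preserved by the
  embedding, and a remainder that is a multiple of the image of \<open>g\<close> but of smaller
  degree is 0. The cofactor of the generator is thereby defined over the small field, where the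
  dimension is taken.\<close>

lemma map_poly_embedding_cofactor:
  fixes f :: "'a::field \<Rightarrow> 'b::field"
  assumes f: "field_embedding f" and eq: "map_poly f g * H = map_poly f m" and "m \<noteq> 0"
  obtains h where "g * h = m" "map_poly f h = H"
proof -
  have g: "g \<noteq> 0"
    using eq \<open>m \<noteq> 0\<close> f by (metis map_poly_0 map_poly_embedding_eq_0_iff mult_zero_left)
  define G where "G = map_poly f g"
  have m: "m = g * (m div g) + m mod g" by simp
  have "map_poly f m = G * map_poly f (m div g) + map_poly f (m mod g)"
    unfolding G_def using f m by (metis map_poly_embedding_add map_poly_embedding_mult)
  then have r: "map_poly f (m mod g) = G * (H - map_poly f (m div g))"
    using eq by (simp add: G_def algebra_simps)
  have "m mod g = 0"
  proof (rule ccontr)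
    assume nz: "m mod g \<noteq> 0"
    then have "degree (m mod g) < degree g" using degree_mod_less g by blast
    moreover have "degree (m mod g) = degree (G * (H - map_poly f (m div g)))"
      using r f by (metis degree_map_poly_embedding)
    moreover have "G * (H - map_poly f (m div g)) \<noteq> 0"
      using nz r f by (metis map_poly_embedding_eq_0_iff)
    ultimately have "degree G < degree g" by (auto simp: degree_mult_eq)
    then show False by (simp add: G_def degree_map_poly_embedding f)
  qed
  then have "G * (H - map_poly f (m div g)) = 0" using r by simp
  moreover have "G \<noteq> 0" using g f by (simp add: G_def map_poly_embedding_eq_0_iff)
  ultimately have "map_poly f (m div g) = H" by simp
  moreover have "g * (m div g) = m" using m \<open>m mod g = 0\<close> by simp
  ultimately show thesis using that by blast
qed

section \<open>The dimension of a cyclic code\<close>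

lemma degree_monom_diff_1: "0 < n \<Longrightarrow> degree (monom 1 n - 1 :: 'a::field poly) = n"
proof -
  assume "0 < n"
  then have "degree (monom 1 n + - 1 :: 'a poly) = n"
    by (subst degree_add_eq_left) (simp_all add: degree_monom_eq)
  then show ?thesis by simp
qed

lemma monom_diff_1_nonzero: "0 < n \<Longrightarrow> monom 1 n - 1 \<noteq> (0 :: 'a::field poly)"
  using degree_monom_diff_1[of n, where 'a = 'a] by force

text \<open>As the modulus is \<open>g * h\<close>, reducing \<open>a * g\<close> amounts to
  reducing \<open>a\<close> modulo \<open>h\<close>.\<close>

lemma cyclic_code_eq:
  fixes g h :: "'a::field poly"
  assumes gh: "g * h = monom 1 n - 1" and n: "0 < n"
  shows "cyclic_code n g = {a * g | a. a = 0 \<or> degree a < degree h}"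
proof -
  have g: "g \<noteq> 0" and h: "h \<noteq> 0"
    using gh monom_diff_1_nonzero[OF n] by auto
  have md: "(a * g) mod (monom 1 n - 1) = (a mod h) * g" for a
    using mod_mult_mult1[of g a h] by (simp add: mult.commute flip: gh)
  have "a mod h = a" if "a = 0 \<or> degree a < degree h" for a
    using that by (auto simp: mod_poly_less)
  moreover have "a mod h = 0 \<or> degree (a mod h) < degree h" for a
    using h degree_mod_less by blast
  ultimately show ?thesis
    unfolding cyclic_code_def md by (intro equalityI subsetI; clarify) metis+
qed

lemma poly_eq_sum_monom:
  assumes "a = 0 \<or> degree a < d"
  shows "a = (\<Sum>i<d. monom (coeff a i) i)"
proof (rule poly_eqI)
  fix k
  show "coeff a k = coeff (\<Sum>i<d. monom (coeff a i) i) k"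
    using assms by (auto simp: coeff_sum if_distrib sum.delta coeff_eq_0 cong: if_cong)
qed

text \<open>The multiples of \<open>g\<close> by the monomials of degree below
  \<open>degree h\<close> form a basis.\<close>

lemma code_dim_cyclic_code:
  fixes g h :: "'a::field poly"
  assumes gh: "g * h = monom 1 n - 1" and n: "0 < n"
  shows "code_dim (cyclic_code n g) = degree h"
proof -
  interpret V: vector_space "smult :: 'a \<Rightarrow> 'a poly \<Rightarrow> 'a poly"
    by standard (simp_all add: smult_add_right smult_add_left)
  have g: "g \<noteq> 0" using gh monom_diff_1_nonzero[OF n] by auto
  define b where "b i = monom 1 i * g" for i
  have inj: "inj_on b A" for A
    using g by (auto simp: inj_on_def b_def monom_eq_iff')
  have comb: "(\<Sum>i<degree h. smult (u i) (b i)) = (\<Sum>i<degree h. monom (u i) i) * g" for u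
    by (simp add: b_def sum_distrib_right smult_monom flip: mult_smult_left)
  have "V.independent (b ` {..<degree h})"
  proof (rule V.independent_if_scalars_zero)
    fix f x
    assume "(\<Sum>x\<in>b ` {..<degree h}. smult (f x) x) = 0" and x: "x \<in> b ` {..<degree h}"
    then have "(\<Sum>i<degree h. smult (f (b i)) (b i)) = 0"
      by (subst (asm) sum.reindex[OF inj]) simp
    then have *: "(\<Sum>i<degree h. monom (f (b i)) i) = 0"
      unfolding comb using g by simp
    obtain k where k: "k < degree h" "x = b k" using x by auto
    have "coeff (\<Sum>i<degree h. monom (f (b i)) i) k = f (b k)"
      using k by (simp add: coeff_sum if_distrib sum.delta cong: if_cong)
    then show "f x = 0" using * k by simp
  qed simp
  moreover have "b ` {..<degree h} \<subseteq> cyclic_code n g"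
    unfolding cyclic_code_eq[OF gh n] by (auto simp: b_def degree_monom_eq)
  moreover have "cyclic_code n g \<subseteq> V.span (b ` {..<degree h})"
  proof
    fix c assume "c \<in> cyclic_code n g"
    then obtain a where a: "a = 0 \<or> degree a < degree h" and c: "c = a * g"
      unfolding cyclic_code_eq[OF gh n] by auto
    have "c = (\<Sum>i<degree h. smult (coeff a i) (b i))"
      unfolding comb c using poly_eq_sum_monom[OF a] by simp
    also have "\<dots> \<in> V.span (b ` {..<degree h})"
      by (intro V.span_sum V.span_scale V.span_base) auto
    finally show "c \<in> V.span (b ` {..<degree h})" .
  qed
  ultimately have "card (b ` {..<degree h}) = V.dim (cyclic_code n g)"
    by (intro V.basis_card_eq_dim)
  then show ?thesis
    by (simp add: code_dim_def card_image[OF inj])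
qed

section \<open>Folding a codeword of length \<open>R * P\<close> to a function modulo
  \<open>P\<close>\<close>

lemma poly_eq_sum_lessThan:
  fixes c :: "'a::comm_semiring_1 poly"
  assumes "degree c < n"
  shows "poly c x = (\<Sum>s<n. coeff c s * x ^ s)"
  unfolding poly_altdef using assms
  by (intro sum.mono_neutral_left) (auto simp: coeff_eq_0)

text \<open>On frequencies in one residue class modulo \<open>R\<close> the symbol modulo
  \<open>R\<close> is constant, so the condition on the product of symbols becomes one on the symbol
  modulo \<open>P\<close>, as \<open>weight_bound\<close> requires.\<close>

lemma hamming_weight_bound:
  fixes c :: "'b::field poly" and P R :: nat
  assumes P: "prime P" "odd P" and R: "prime R" and PR: "P \<noteq> R"
    and \<beta>: "\<And>k. \<beta> ^ k = 1 \<longleftrightarrow> R * P dvd k"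
    and P_nz: "of_nat P \<noteq> (0::'b)"
    and c: "c \<noteq> 0" "degree c < R * P"
    and \<delta>: "\<delta> \<noteq> 0"
    and supp: "\<And>k. poly c (\<beta> ^ k) \<noteq> 0 \<Longrightarrow> P dvd k \<or> Legendre k R * Legendre k P = \<delta>"
  shows "P \<le> (hamming_weight c)\<^sup>2"
proof -
  have cop: "coprime R P" using P R PR by (simp add: primes_coprime)
  have n0: "R * P > 0" using P R by (simp add: prime_gt_0_nat)
  have \<beta>_cong: "\<beta> ^ a = \<beta> ^ b" if "[a = b] (mod R * P)" for a b
  proof -
    have "\<beta> ^ a = \<beta> ^ (a mod (R * P))" for a
    proof -
      have "\<beta> ^ a = \<beta> ^ (R * P * (a div (R * P)) + a mod (R * P))" by simp
      also have "\<dots> = \<beta> ^ (a mod (R * P))"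
        using \<beta>[of "R * P"] by (simp only: power_add power_mult[of _ "R * P"]) simp
      finally show ?thesis .
    qed
    then show ?thesis using that unfolding cong_def by metis
  qed
  define \<zeta> where "\<zeta> = \<beta> ^ R"
  interpret prime_unity_root P \<zeta>
  proof
    show "\<zeta> ^ P = 1" "\<zeta> \<noteq> 1"
      using P R prime_gt_1_nat[of P] unfolding \<zeta>_def power_mult[symmetric] \<beta>
      by (auto dest!: dvd_imp_le simp: prime_gt_0_nat)
  qed (use P P_nz in auto)
  \<comment> \<open>The \<open>R * P\<close> powers of \<beta> are distinct, more than the degree of
    \<open>c\<close>, so they cannot all be roots.\<close>
  obtain k1 where k1: "poly c (\<beta> ^ k1) \<noteq> 0"
  proof -
    have "inj_on (\<lambda>k. \<beta> ^ k) {..<R * P}"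
    proof (rule linorder_inj_onI')
      fix a b assume ab: "a \<in> {..<R * P}" "b \<in> {..<R * P}" "a < b"
      have "\<beta> \<noteq> 0" using \<beta>[of "R * P"] n0 by (metis dvd_refl power_0_left less_irrefl zero_neq_one)
      show "\<beta> ^ a \<noteq> \<beta> ^ b"
      proof
        assume "\<beta> ^ a = \<beta> ^ b"
        then have "\<beta> ^ (b - a) = 1"
          using ab \<open>\<beta> \<noteq> 0\<close> by (intro power_diff_eq_1) auto
        then show False using ab unfolding \<beta> by (auto dest!: dvd_imp_le)
      qed
    qed
    then have card: "card ((\<lambda>k. \<beta> ^ k) ` {..<R * P}) = R * P" by (simp add: card_image)
    have "\<exists>k. poly c (\<beta> ^ k) \<noteq> 0"
    proof (rule ccontr)
      assume "\<nexists>k. poly c (\<beta> ^ k) \<noteq> 0"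
      then have "(\<lambda>k. \<beta> ^ k) ` {..<R * P} \<subseteq> {x. poly c x = 0}" by auto
      then have "R * P \<le> card {x. poly c x = 0}"
        using card_mono[OF poly_roots_finite[OF c(1)]] card by metis
      also have "\<dots> \<le> degree c" using card_poly_roots_bound[OF c(1)] .
      finally show False using c by simp
    qed
    then show thesis using that by blast
  qed
  \<comment> \<open>Being 0 modulo \<open>P\<close>, this representative makes
    \<open>k0 + R * b\<close> run through the class of \<open>k1\<close> modulo \<open>R\<close>
    while reducing to \<open>R * b\<close> modulo \<open>P\<close>.\<close>
  obtain k0 where k0: "[k0 = k1] (mod R)" "[k0 = 0] (mod P)"
    using binary_chinese_remainder_nat[OF cop] by blast
  \<comment> \<open>Coefficients at positions congruent modulo \<open>P\<close> are added up. The
    twist by \<open>\<beta> ^ (k0 * s)\<close> shifts the frequency, so that the transform at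
    \<open>b\<close> is the value of \<open>c\<close> at
    \<open>\<beta> ^ (k0 + R * b)\<close>.\<close>
  define v where "v t = (\<Sum>s | s < R * P \<and> int s mod int P = t mod int P. coeff c s * \<beta> ^ (k0 * s))" for t
  have per: "periodic v" by (simp add: periodic_def v_def)
  have dft_v: "dft v b = poly c (\<beta> ^ (k0 + R * nat (b mod int P)))" for b
  proof -
    define b' where "b' = nat (b mod int P)"
    have b': "[b = int b'] (mod int P)" using p_gt_2 by (simp add: b'_def cong_def)
    have e: "e (b * int s) = \<beta> ^ (R * b' * s)" for s
    proof -
      have "[b * int s = int (b' * s)] (mod int P)"
        using cong_mult[OF b' cong_refl[of "int s"]] by simp
      then have "e (b * int s) = e (int (b' * s))" unfolding cong_def by (metis e_mod)
      also have "\<dots> = \<beta> ^ (R * b' * s)"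
        unfolding e_of_nat by (simp add: \<zeta>_def mult.assoc flip: power_mult)
      finally show ?thesis .
    qed
    have "dft v b = (\<Sum>t\<in>{0..<int P}. \<Sum>s | s < R * P \<and> int s mod int P = t mod int P. coeff c s * \<beta> ^ (k0 * s) * e (b * int s))"
      unfolding dft_def v_def sum_distrib_right
    proof (intro sum.cong refl)
      fix t s assume "s \<in> {s. s < R * P \<and> int s mod int P = t mod int P}"
      then have "[b * t = b * int s] (mod int P)"
        by (intro cong_mult cong_refl) (simp add: cong_def)
      then have "e (b * t) = e (b * int s)" unfolding cong_def by (metis e_mod)
      then show "coeff c s * \<beta> ^ (k0 * s) * e (b * t) = coeff c s * \<beta> ^ (k0 * s) * e (b * int s)" by simp
    qed
    also have "\<dots> = (\<Sum>t\<in>{0..<int P}. \<Sum>s | s \<in> {..<R * P} \<and> int s mod int P = t. coeff c s * \<beta> ^ (k0 * s) * e (b * int s))"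
      by (intro sum.cong refl) auto
    also have "\<dots> = (\<Sum>s<R * P. coeff c s * \<beta> ^ (k0 * s) * e (b * int s))"
      using p_gt_2 by (intro sum.group) auto
    also have "\<dots> = (\<Sum>s<R * P. coeff c s * (\<beta> ^ (k0 + R * b')) ^ s)"
      by (simp add: e algebra_simps flip: power_add power_mult)
    finally show ?thesis using poly_eq_sum_lessThan[OF c(2)] by (simp add: b'_def)
  qed
  \<comment> \<open>Solves \<open>Legendre k1 R * Legendre R P * Legendre b P = \<delta>\<close> for
    the symbol of \<open>b\<close> when \<open>R\<close> does not divide \<open>k1\<close>.
    Otherwise \<epsilon> is 0, and the product is 0 too, hence not \<delta>.\<close>
  define \<epsilon> where "\<epsilon> = Legendre k1 R * Legendre R P * \<delta>"
  have "int P dvd b \<or> Legendre b P = \<epsilon>" if b: "dft v b \<noteq> 0" for b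
  proof (rule disjCI)
    assume neq: "Legendre b P \<noteq> \<epsilon>"
    define b' where "b' = nat (b mod int P)"
    have b': "int b' = b mod int P" using p_gt_2 by (simp add: b'_def)
    define k where "k = k0 + R * b'"
    have kR: "[k = k1] (mod R)" using k0(1) by (simp add: k_def cong_def)
    have kP: "[k = R * b'] (mod P)"
      using cong_add[OF k0(2) cong_refl[of "R * b'"]] by (simp add: k_def)
    have "Legendre k R = Legendre k1 R"
      using kR by (intro Legendre_cong) (simp add: cong_int_iff)
    moreover have "Legendre k P = Legendre R P * Legendre b P"
    proof -
      have "Legendre k P = Legendre (int (R * b')) P"
        using kP by (intro Legendre_cong) (simp only: cong_int_iff)
      also have "\<dots> = Legendre R P * Legendre b P"
        using Legendre_mult[OF p, of R "int b'"] by (simp add: b')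
      finally show ?thesis .
    qed
    moreover have "Legendre R P \<noteq> 0"
      using cop p P(1) R PR by (auto simp: Legendre_eq_0_iff dest: primes_dvd_imp_eq)
    ultimately have "Legendre k R * Legendre k P \<noteq> \<delta>"
      using neq \<delta> Legendre_values[of k1 R] Legendre_values[of R P] by (auto simp: \<epsilon>_def)
    moreover have "poly c (\<beta> ^ k) \<noteq> 0" using b by (simp add: dft_v k_def b'_def)
    ultimately have "P dvd k" using supp by blast
    then have "P dvd R * b'" using kP cong_dvd_iff by blast
    then have "P dvd b'" using cop by (metis coprime_commute coprime_dvd_mult_right_iff)
    then show "int P dvd b" by (metis b' dvd_mod_iff dvd_refl int_dvd_int_iff)
  qed
  moreover obtain t0 where "v t0 \<noteq> 0"
  proof -
    \<comment> \<open>Solving \<open>R * b = k1\<close> modulo \<open>P\<close> makes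
      \<open>k0 + R * b\<close> congruent to \<open>k1\<close> modulo both primes. So the frequency
      \<open>k1\<close>, where \<open>c\<close> does not vanish, survives the folding, and
      \<open>v\<close> is not zero.\<close>
    obtain x where x: "[R * x = 1] (mod P)" using cong_solve_coprime_nat[OF cop] by auto
    define b where "b = x * k1 mod P"
    have "[R * b = R * x * k1] (mod P)"
      unfolding b_def by (simp add: cong_def mod_mult_right_eq mult.assoc)
    also have "[R * x * k1 = 1 * k1] (mod P)" by (intro cong_mult cong_refl x)
    finally have "[k0 + R * b = 0 + k1] (mod P)"
      using k0(2) by (intro cong_add) simp_all
    moreover have "[k0 + R * b = k1] (mod R)" using k0(1) by (simp add: cong_def)
    ultimately have "[k0 + R * b = k1] (mod R * P)"
      using cop by (simp add: coprime_cong_mult_nat)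
    then have "poly c (\<beta> ^ (k0 + R * b)) \<noteq> 0" using \<beta>_cong k1 by metis
    moreover have "nat (int b mod int P) = b"
      by (simp add: b_def flip: zmod_int)
    ultimately have "dft v (int b) \<noteq> 0" by (simp add: dft_v)
    then have "\<exists>t. v t \<noteq> 0" unfolding dft_def by (metis (no_types, lifting) mult_zero_left sum.neutral)
    then show thesis using that by blast
  qed
  ultimately have "P \<le> (weight v)\<^sup>2" using weight_bound[OF per] by blast
  moreover have "weight v \<le> hamming_weight c"
  proof -
    have fin: "finite {s. coeff c s \<noteq> 0}"
      by (rule finite_subset[of _ "{..degree c}"]) (auto intro: le_degree)
    have "{t \<in> {0..<int P}. v t \<noteq> 0} \<subseteq> (\<lambda>s. int s mod int P) ` {s. coeff c s \<noteq> 0}"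
    proof
      fix t assume t: "t \<in> {t \<in> {0..<int P}. v t \<noteq> 0}"
      then obtain s where "int s mod int P = t mod int P" "coeff c s \<noteq> 0"
        unfolding v_def by (smt (verit) mem_Collect_eq mult_zero_left sum.neutral)
      then show "t \<in> (\<lambda>s. int s mod int P) ` {s. coeff c s \<noteq> 0}"
        using t by (intro image_eqI[of _ _ s]) auto
    qed
    then show ?thesis
      unfolding weight_def hamming_weight_def by (rule surj_card_le[OF fin])
  qed
  ultimately show ?thesis by (meson le_trans power_mono zero_le)
qed

subsection \<open>Whiteman classes\<close>

lemma cong_power_eq_imp_ord_dvd:
  fixes n g s t :: nat
  assumes "coprime n g" "[g ^ s = g ^ t] (mod n)" "s \<le> t"
  shows "ord n g dvd t - s"
proof -
  have "[g ^ s * g ^ (t - s) = g ^ s * 1] (mod n)"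
    using assms by (simp add: cong_sym flip: power_add)
  then have "[g ^ (t - s) = 1] (mod n)"
    using assms(1) cong_mult_lcancel_nat[of "g ^ s" n "g ^ (t - s)" 1]
    by (simp only: coprime_power_left_iff coprime_commute[of g n]) simp
  then show ?thesis by (simp only: ord_divides)
qed

text \<open>Two exponents giving the same element differ by a multiple of \<open>n1 - 1\<close> and
  of \<open>n2 - 1\<close>. The least common multiple of these is the number of exponents, because
  their gcd is 6.\<close>

lemma card_whiteman_class:
  assumes "prime n1" "prime n2" "n1 \<noteq> n2"
    and gcd: "gcd (n1 - 1) (n2 - 1) = 6"
    and "residue_primroot n1 g" "residue_primroot n2 g"
    and u: "coprime u (n1 * n2)"
  shows "card (whiteman_class n1 n2 g u j) = (n1 - 1) * (n2 - 1) div 6"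
proof -
  let ?e = "(n1 - 1) * (n2 - 1) div 6"
  have cop: "coprime n1 g" "coprime n2 g" and ord: "ord n1 g = n1 - 1" "ord n2 g = n2 - 1"
    using assms by (auto simp: residue_primroot_def totient_prime)
  have lcm: "lcm (n1 - 1) (n2 - 1) = ?e"
    unfolding lcm_nat_def gcd ..
  have "inj_on (\<lambda>s. (g ^ s * u ^ j) mod (n1 * n2)) {..<?e}"
  proof (rule linorder_inj_onI')
    fix s t assume st: "s \<in> {..<?e}" "t \<in> {..<?e}" "s < t"
    show "(g ^ s * u ^ j) mod (n1 * n2) \<noteq> (g ^ t * u ^ j) mod (n1 * n2)"
    proof
      assume "(g ^ s * u ^ j) mod (n1 * n2) = (g ^ t * u ^ j) mod (n1 * n2)"
      then have "[g ^ s = g ^ t] (mod n1 * n2)"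
        unfolding cong_def[symmetric] using u by (simp add: cong_mult_rcancel_nat coprime_commute)
      then have "[g ^ s = g ^ t] (mod n1)" "[g ^ s = g ^ t] (mod n2)"
        by (auto intro: cong_dvd_modulus_nat)
      then have "n1 - 1 dvd t - s" "n2 - 1 dvd t - s"
        using cong_power_eq_imp_ord_dvd[OF cop(1)] cong_power_eq_imp_ord_dvd[OF cop(2)] ord st
        by (metis less_imp_le)+
      then have "?e dvd t - s" by (metis lcm lcm_least)
      then show False using st by (auto dest!: dvd_imp_le)
    qed
  qed
  moreover have "whiteman_class n1 n2 g u j = (\<lambda>s. (g ^ s * u ^ j) mod (n1 * n2)) ` {..<?e}"
    by (auto simp: whiteman_class_def)
  ultimately show ?thesis by (simp add: card_image)
qed

text \<open>The primitive root \<open>g\<close> is a nonresidue modulo both primes, so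
  \<open>g ^ s\<close> contributes two equal signs. Each factor \<open>u\<close> contributes -1
  modulo \<open>n1\<close> and 1 modulo \<open>n2\<close>.\<close>

lemma Legendre_whiteman_class:
  assumes p: "prime n1" "odd n1" "prime n2" "odd n2"
    and g: "residue_primroot n1 g" "residue_primroot n2 g"
    and u: "[u = g] (mod n1)" "[u = 1] (mod n2)"
    and l: "l \<in> whiteman_class n1 n2 g u j" and k: "[k = l] (mod n1 * n2)"
  shows "Legendre k n1 * Legendre k n2 = (-1) ^ j"
proof -
  obtain s where s: "[k = g ^ s * u ^ j] (mod n1 * n2)"
    using l k unfolding whiteman_class_def cong_def by auto
  have "[k = g ^ s * u ^ j] (mod n1)"
    using s by (rule cong_dvd_modulus_nat) simp
  also have "[g ^ s * u ^ j = g ^ s * g ^ j] (mod n1)"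
    by (intro cong_mult cong_pow cong_refl u)
  finally have "[k = g ^ (s + j)] (mod n1)" by (simp only: power_add)
  then have "Legendre k n1 = Legendre (int (g ^ (s + j))) n1"
    by (intro Legendre_cong) (simp only: cong_int_iff)
  then have 1: "Legendre k n1 = (-1) ^ (s + j)"
    by (simp only: of_nat_power Legendre_power[OF p(1,2)] Legendre_primroot[OF p(1,2) g(1)])
  have "[k = g ^ s * u ^ j] (mod n2)"
    using s by (rule cong_dvd_modulus_nat) simp
  also have "[g ^ s * u ^ j = g ^ s * 1 ^ j] (mod n2)"
    by (intro cong_mult cong_pow cong_refl u)
  finally have "[k = g ^ s] (mod n2)" by simp
  then have "Legendre k n2 = Legendre (int (g ^ s)) n2"
    by (intro Legendre_cong) (simp only: cong_int_iff)
  then have "Legendre k n2 = (-1) ^ s"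
    by (simp only: of_nat_power Legendre_power[OF p(3,4)] Legendre_primroot[OF p(3,4) g(2)])
  with 1 show ?thesis
    by (simp add: power_add mult_ac flip: power_mult_distrib)
qed

section \<open>Roots of the class polynomials and bounds on the minimum distance\<close>

lemma degree_d_poly: "finite D \<Longrightarrow> degree (d_poly \<beta> D) = card D"
  unfolding d_poly_def by (subst degree_prod_eq_sum_degree) auto

lemma poly_d_poly_eq_0_iff:
  "finite D \<Longrightarrow> poly (d_poly \<beta> D) x = 0 \<longleftrightarrow> (\<exists>k\<in>D. x = \<beta> ^ k)"
  by (auto simp: d_poly_def poly_prod)

lemma finite_whiteman_class [simp]: "finite (whiteman_class n1 n2 g u j)"
  by (simp add: whiteman_class_def)

text \<open>\<open>Min\<close> is informative only on finite nonempty sets: the degree bound gives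
  finiteness, the nonzero codeword nonemptiness.\<close>

lemma min_distance_geI:
  assumes "\<And>c. c \<in> C \<Longrightarrow> degree c \<le> n" "C - {0} \<noteq> {}"
    and "\<And>c. c \<in> C \<Longrightarrow> c \<noteq> 0 \<Longrightarrow> w \<le> hamming_weight c"
  shows "w \<le> min_distance C"
proof -
  have "hamming_weight c \<le> Suc n" if "c \<in> C" for c
  proof -
    have "{i. coeff c i \<noteq> 0} \<subseteq> {..n}"
    proof
      fix i assume "i \<in> {i. coeff c i \<noteq> 0}"
      then have "i \<le> degree c" by (simp add: le_degree)
      with assms(1)[OF that] show "i \<in> {..n}" by simp
    qed
    then have "card {i. coeff c i \<noteq> 0} \<le> card {..n}" by (intro card_mono) auto
    then show ?thesis by (simp add: hamming_weight_def)
  qed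
  then have "hamming_weight ` (C - {0}) \<subseteq> {..Suc n}" by auto
  then have "finite (hamming_weight ` (C - {0}))" by (rule finite_subset) simp
  then show ?thesis
    unfolding min_distance_def using assms(2,3) by (subst Min_ge_iff) auto
qed

section \<open>Dimension and minimum distance of the codes\<close>

theorem theorem5:
  fixes n1 n2 g u q i j :: nat
    and emb :: "'a::{finite,field} \<Rightarrow> 'b::{finite,field}"
    and \<alpha> :: 'b
    and gp :: "'a poly"
  assumes "prime n1" "prime n2" "odd n1" "odd n2" "n1 \<noteq> n2"
    and "gcd (n1 - 1) (n2 - 1) = 6"
    and "residue_primroot n1 g" "residue_primroot n2 g"
    and "[u = g] (mod n1)" "[u = 1] (mod n2)"
    and "q = CARD('a)" "coprime q (n1 * n2)"
    and "q mod (n1 * n2) \<in> whiteman_class n1 n2 g u 0"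
    and "field_embedding emb"
    and "CARD('b) = q ^ ord (n1 * n2) q"
    and "primitive_element \<alpha>"
    and "i \<in> {1, 2}" "j \<le> 5"
    and "map_poly emb gp *
           ((monom 1 (if i = 1 then n1 else n2) - 1) *
            d_poly (\<alpha> ^ ((CARD('b) - 1) div (n1 * n2))) (whiteman_class n1 n2 g u j))
         = monom 1 (n1 * n2) - 1"
  shows "code_dim (cyclic_code (n1 * n2) gp)
           = (if i = 1 then n1 else n2) + (n1 - 1) * (n2 - 1) div 6
         \<and> real (min_distance (cyclic_code (n1 * n2) gp))
           \<ge> of_int \<lceil>sqrt (real (if i = 1 then n2 else n1))\<rceil>"
proof -
  \<comment> \<open>The roots of \<open>monom 1 R - 1\<close> among the powers of \<beta> are those
    whose exponent is divisible by the other prime \<open>P\<close>, and \<open>P\<close> is the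
    prime under the square root.\<close>
  define R P where "R = (if i = 1 then n1 else n2)" and "P = (if i = 1 then n2 else n1)"
  define D where "D = whiteman_class n1 n2 g u j"
  define \<beta> where "\<beta> = \<alpha> ^ ((CARD('b) - 1) div (n1 * n2))"
  define H where "H = (monom 1 R - 1) * d_poly \<beta> D"
  note emb = \<open>field_embedding emb\<close>
  have RP: "n1 * n2 = R * P" by (simp add: R_def P_def)
  have prime: "prime R" "prime P" "odd P" "P \<noteq> R"
    using assms by (auto simp: R_def P_def)
  have pos: "R > 0" "R * P > 0" using prime by (simp_all add: prime_gt_0_nat)
  have finD: "finite D" by (simp add: D_def)

  have "coprime (n1 * n2) q" using \<open>coprime q (n1 * n2)\<close> by (simp add: coprime_commute)
  then have "[q ^ ord (n1 * n2) q = 1] (mod n1 * n2)" using ord by blast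
  then have "n1 * n2 dvd q ^ ord (n1 * n2) q - 1" by (rule cong_to_1_nat)
  then have n_dvd: "R * P dvd CARD('b) - 1"
    unfolding \<open>CARD('b) = _\<close> RP .
  \<comment> \<open>Since \<open>0 ^ 0 = 1\<close>, the element 0 would count as primitive in a
    field with two elements. Such a field is impossible here, as \<open>R * P\<close> divides
    \<open>CARD('b) - 1\<close>.\<close>
  have card2: "CARD('b) > 2"
  proof -
    have "card {0, 1 :: 'b} \<le> CARD('b)" by (intro card_mono) auto
    then have "CARD('b) \<ge> 2" by simp
    moreover have "R * P > 1" using prime by (metis less_1_mult prime_gt_1_nat)
    ultimately show ?thesis using n_dvd by (cases "CARD('b) = 2") auto
  qed
  have "\<alpha> \<noteq> 0"
  proof
    assume "\<alpha> = 0"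
    have "(UNIV :: 'b set) \<subseteq> {0, 1}"
    proof
      fix x :: 'b
      show "x \<in> {0, 1}"
      proof (cases "x = 0")
        case False
        then obtain k where "x = \<alpha> ^ k"
          using \<open>primitive_element \<alpha>\<close> unfolding primitive_element_def by blast
        with False \<open>\<alpha> = 0\<close> show ?thesis by (cases k) auto
      qed simp
    qed
    then have "CARD('b) \<le> card {0, 1 :: 'b}" by (intro card_mono) auto
    then show False using card2 by simp
  qed
  have \<beta>: "\<beta> ^ k = 1 \<longleftrightarrow> R * P dvd k" for k
  proof -
    obtain x where x: "CARD('b) - 1 = R * P * x" using n_dvd by blast
    then have "x > 0" using card2 by (cases x) auto
    then show ?thesis
      unfolding \<beta>_def RP power_mult[symmetric]
        primitive_element_power_eq_1_iff[OF \<open>primitive_element \<alpha>\<close> \<open>\<alpha> \<noteq> 0\<close>]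
      using x pos by (simp add: mult.commute)
  qed
  have P_nz: "of_nat P \<noteq> (0 :: 'b)"
  proof (rule of_nat_nonzero_if_coprime_card)
    have "coprime P q" using \<open>coprime (n1 * n2) q\<close> by (simp add: RP)
    then show "coprime P (CARD('b))" using \<open>CARD('b) = _\<close> by simp
  qed

  have "map_poly emb gp * H = map_poly emb (monom 1 (R * P) - 1)"
    using assms(19)
    unfolding map_poly_embedding_monom_diff_1[OF emb] RP[symmetric]
    unfolding H_def R_def \<beta>_def D_def .
  then obtain h where h: "gp * h = monom 1 (R * P) - 1" "map_poly emb h = H"
    using map_poly_embedding_cofactor[OF emb _ monom_diff_1_nonzero[OF pos(2)]] by blast
  have "coprime u n1"
    using assms(5-9) by (metis cong_imp_coprime cong_sym coprime_commute residue_primroot_def)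
  moreover have "coprime u n2"
    using assms(10) by (metis cong_imp_coprime cong_sym coprime_1_left)
  ultimately have "card D = (n1 - 1) * (n2 - 1) div 6"
    unfolding D_def using assms(1-8) by (intro card_whiteman_class) auto
  moreover have "d_poly \<beta> D \<noteq> 0" using finD by (simp add: d_poly_def)
  ultimately have "degree H = R + (n1 - 1) * (n2 - 1) div 6"
    using monom_diff_1_nonzero[OF pos(1), where 'a = 'b]
    by (simp add: H_def degree_mult_eq degree_monom_diff_1 degree_d_poly pos finD)
  then have deg_h: "degree h = R + (n1 - 1) * (n2 - 1) div 6"
    using h(2) degree_map_poly_embedding[OF emb] by metis
  then have dim: "code_dim (cyclic_code (n1 * n2) gp) = R + (n1 - 1) * (n2 - 1) div 6"
    unfolding RP using code_dim_cyclic_code[OF h(1) pos(2)] by simp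

  have gp: "gp \<noteq> 0" using h(1) monom_diff_1_nonzero[OF pos(2)] by (metis mult_zero_left)
  \<comment> \<open>A power of \<beta> that is no root of the generator is a root of
    \<open>H\<close>: either of \<open>monom 1 R - 1\<close>, so that \<open>P\<close> divides
    \<open>k\<close>, or of \<open>d_poly \<beta> D\<close>, so that \<open>k\<close> reduces to an
    element of the Whiteman class.\<close>
  have zeros: "P dvd k \<or> Legendre k R * Legendre k P = (-1) ^ j"
    if k: "poly (map_poly emb gp) (\<beta> ^ k) \<noteq> 0" for k
  proof -
    have "map_poly emb gp * H = monom 1 (R * P) - 1"
      using h map_poly_embedding_mult[OF emb] map_poly_embedding_monom_diff_1[OF emb] by metis
    then have "poly (map_poly emb gp) (\<beta> ^ k) * poly H (\<beta> ^ k) = (\<beta> ^ k) ^ (R * P) - 1"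
      by (metis poly_1 poly_diff poly_monom poly_mult mult_1)
    also have "(\<beta> ^ k) ^ (R * P) = 1" unfolding power_mult[symmetric] \<beta> by simp
    finally have "poly H (\<beta> ^ k) = 0" using k by simp
    then consider "(\<beta> ^ k) ^ R = 1" | "poly (d_poly \<beta> D) (\<beta> ^ k) = 0"
      by (auto simp: H_def poly_monom)
    then show ?thesis
    proof cases
      case 1
      then have "R * P dvd k * R" unfolding power_mult[symmetric] \<beta> .
      then show ?thesis using pos by simp
    next
      case 2
      then obtain l where l: "l \<in> D" "\<beta> ^ k = \<beta> ^ l"
        using poly_d_poly_eq_0_iff[OF finD] by blast
      have "\<beta> \<noteq> 0" using \<open>\<alpha> \<noteq> 0\<close> by (simp add: \<beta>_def)
      have "[k = l] (mod R * P)"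
      proof (cases "k \<le> l")
        case True
        then have "R * P dvd l - k" using power_diff_eq_1[OF \<open>\<beta> \<noteq> 0\<close> True l(2)] by (simp add: \<beta>)
        then have "[l = k] (mod R * P)" using True by (simp add: cong_altdef_nat)
        then show ?thesis by (rule cong_sym)
      next
        case False
        then have "R * P dvd k - l"
          using power_diff_eq_1[OF \<open>\<beta> \<noteq> 0\<close> _ l(2)[symmetric]] by (simp add: \<beta>)
        then show ?thesis using False by (simp add: cong_altdef_nat)
      qed
      then have "Legendre k n1 * Legendre k n2 = (-1) ^ j"
        using assms l(1) unfolding D_def RP[symmetric]
        by (intro Legendre_whiteman_class[of n1 n2 g u l j k]) auto
      then show ?thesis by (simp add: R_def P_def mult.commute split: if_splits)
    qed
  qed
  have deg: "degree c < R * P" if "c \<in> cyclic_code (R * P) gp" for c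
  proof -
    obtain a where "c = (a * gp) mod (monom 1 (R * P) - 1)"
      using \<open>c \<in> _\<close> by (auto simp: cyclic_code_def)
    then show ?thesis
      using degree_mod_less'[of "monom 1 (R * P) - 1" "a * gp"] monom_diff_1_nonzero[OF pos(2), where 'a = 'a]
        degree_monom_diff_1[OF pos(2), where 'a = 'a] pos by (cases "c = 0") auto
  qed
  have weight: "P \<le> (hamming_weight c)\<^sup>2" if c: "c \<in> cyclic_code (R * P) gp" "c \<noteq> 0" for c
  proof -
    obtain a where "c = a * gp"
      using c(1) cyclic_code_eq[OF h(1) pos(2)] by auto
    then have a: "map_poly emb c = map_poly emb a * map_poly emb gp"
      by (simp add: map_poly_embedding_mult emb)
    \<comment> \<open>The bound is applied over the splitting field containing \<beta>. The
      embedding sends exactly 0 to 0, so weights are unchanged.\<close>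
    have "P \<le> (hamming_weight (map_poly emb c))\<^sup>2"
    proof (rule hamming_weight_bound[OF prime(2,3,1,4) \<beta> P_nz])
      show "map_poly emb c \<noteq> 0" "degree (map_poly emb c) < R * P"
        using c deg by (simp_all add: map_poly_embedding_eq_0_iff degree_map_poly_embedding emb)
      show "P dvd k \<or> Legendre k R * Legendre k P = (-1) ^ j"
        if "poly (map_poly emb c) (\<beta> ^ k) \<noteq> 0" for k
        using zeros that by (simp add: a)
    qed simp
    moreover have "hamming_weight (map_poly emb c) = hamming_weight c"
      by (simp add: hamming_weight_def coeff_map_poly field_embedding_0 field_embedding_eq_0_iff emb)
    ultimately show ?thesis by simp
  qed
  have "nat \<lceil>sqrt (real P)\<rceil> \<le> min_distance (cyclic_code (R * P) gp)"
  proof (rule min_distance_geI)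
    show "degree c \<le> R * P" if "c \<in> cyclic_code (R * P) gp" for c
      using deg[OF that] by simp
    have "1 * gp \<in> cyclic_code (R * P) gp"
      unfolding cyclic_code_eq[OF h(1) pos(2)] using deg_h pos by force
    then show "cyclic_code (R * P) gp - {0} \<noteq> {}" using gp by auto
    fix c assume "c \<in> cyclic_code (R * P) gp" "c \<noteq> 0"
    then have "real P \<le> real (hamming_weight c) ^ 2"
      using weight by (simp flip: of_nat_power)
    then have "sqrt (real P) \<le> real (hamming_weight c)"
      by (intro real_le_lsqrt) auto
    then show "nat \<lceil>sqrt (real P)\<rceil> \<le> hamming_weight c"
      by (simp add: ceiling_le_iff nat_le_iff)
  qed
  then have "real (min_distance (cyclic_code (R * P) gp)) \<ge> of_int \<lceil>sqrt (real P)\<rceil>"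
    by linarith
  with dim show ?thesis
    unfolding RP R_def[symmetric] P_def[symmetric] by simp
qed

end
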